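(* For every discrete random variable $W$ on $\{0,\dots,n_0\}$, where $n_0<\infty$, there exists a number $n=n(W)$ such that $W+B_n$ is strictly log-concave, where $B_n$ is a Binomial$(n,1/2)$ random variable independent of $W$.
   Context: A discrete distribution $\boldsymbol\mu$ on $\{0,\dots,k\}$ is log-concave if $\mu_i^2\ge\mu_{i-1}\mu_{i+1}$ for all $0<i<k$; if the inequality is strict, $\boldsymbol\mu$ is said to be strictly log-concave. A random variable is called (strictly) log-concave if its distribution is.
   Formalization: Strict log-concavity is required only strictly between the smallest and largest points of the support, not for all 0<i<k; read literally the claim fails, e.g. for W=2 almost surely, where at i=1 the inequality for W+B_n is 0>0. *)

theory Defs
  imports "HOL-Probability.Probability"
begin

(* The interval {a..b} on which the distribution lives is taken to be the smallest one containing
   its support: at an index outside the support the strict inequality would read 0 > 0, so that for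
   instance a point mass at 0 viewed on {0..2} would fail it.  If mu 0 and mu k are positive and
   mu vanishes beyond k, then a = 0 and b = k. *)
definition strictly_log_concave :: "(nat \<Rightarrow> real) \<Rightarrow> bool" where
  "strictly_log_concave \<mu> \<longleftrightarrow>
     (\<exists>a b. \<mu> a \<noteq> 0 \<and> \<mu> b \<noteq> 0 \<and> (\<forall>i. \<mu> i \<noteq> 0 \<longrightarrow> a \<le> i \<and> i \<le> b) \<and>
            (\<forall>i. a < i \<and> i < b \<longrightarrow> (\<mu> i)\<^sup>2 > \<mu> (i - 1) * \<mu> (i + 1)))"

definition strictly_log_concave_rv :: "'a measure \<Rightarrow> ('a \<Rightarrow> nat) \<Rightarrow> bool" where
  "strictly_log_concave_rv M X \<longleftrightarrow>
     strictly_log_concave (\<lambda>i. measure (distr M (count_space UNIV) X) {i})"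

(* W need not live on a space that carries a binomial variable independent of it, so the space is
   extended by a binomial factor.  The law of W + B only depends on the laws of W and B and on their
   independence, hence it is the same for every other choice of the space. *)
abbreviation with_binomial :: "'a measure \<Rightarrow> nat \<Rightarrow> ('a \<times> nat) measure" where
  "with_binomial M n \<equiv> M \<Otimes>\<^sub>M measure_pmf (binomial_pmf n (1/2))"

lemma with_binomial:
  fixes M :: "'a measure" and W :: "'a \<Rightarrow> nat" and n :: nat
  assumes M: "prob_space M" and W: "W \<in> measurable M (count_space UNIV)"
  shows "prob_space (with_binomial M n)"
    and "distr (with_binomial M n) (count_space UNIV) (\<lambda>\<omega>. W (fst \<omega>)) = distr M (count_space UNIV) W"
    and "distr (with_binomial M n) (count_space UNIV) snd = measure_pmf (binomial_pmf n (1/2))"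
    and "prob_space.indep_var (with_binomial M n)
           (count_space UNIV) (\<lambda>\<omega>. W (fst \<omega>)) (count_space UNIV) snd"
proof -
  let ?B = "measure_pmf (binomial_pmf n (1/2))"
  interpret M: prob_space M by (rule M)
  interpret P: pair_prob_space M ?B ..
  show ps: "prob_space (with_binomial M n)" by (rule P.prob_space_axioms)
  have fst': "fst \<in> measurable (with_binomial M n) M" by measurable
  have Wf: "(\<lambda>\<omega>. W (fst \<omega>)) \<in> measurable (with_binomial M n) (count_space UNIV)"
    using measurable_compose[OF fst' W] .
  have s: "snd \<in> measurable (with_binomial M n) (count_space UNIV)"
    using measurable_snd[of M ?B] measurable_cong_sets[OF refl sets_measure_pmf_count_space] by blast
  have dfst: "distr (with_binomial M n) M fst = M"
    by (rule prob_space.distr_pair_fst[OF measure_pmf.prob_space_axioms])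
  have 1: "distr (with_binomial M n) (count_space UNIV) (\<lambda>\<omega>. W (fst \<omega>))
      = distr (distr (with_binomial M n) M fst) (count_space UNIV) W"
    using distr_distr[OF W fst'] by (simp add: comp_def)
  then show d1: "distr (with_binomial M n) (count_space UNIV) (\<lambda>\<omega>. W (fst \<omega>)) = distr M (count_space UNIV) W"
    by (simp add: dfst)
  show d2: "distr (with_binomial M n) (count_space UNIV) snd = ?B"
  proof (rule measure_eqI)
    fix A :: "nat set"
    have "emeasure (distr (with_binomial M n) (count_space UNIV) snd) A
        = emeasure (with_binomial M n) (space M \<times> A)"
      using s by (subst emeasure_distr)
        (auto simp: space_pair_measure intro!: arg_cong2[where f = emeasure])
    also have "\<dots> = emeasure ?B A"
      by (subst measure_pmf.emeasure_pair_measure_Times) (auto simp: M.emeasure_space_1)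
    finally show "emeasure (distr (with_binomial M n) (count_space UNIV) snd) A = emeasure ?B A" .
  qed simp
  show "prob_space.indep_var (with_binomial M n)
           (count_space UNIV) (\<lambda>\<omega>. W (fst \<omega>)) (count_space UNIV) snd"
  proof -
    have "distr M (count_space UNIV) W \<Otimes>\<^sub>M distr ?B (count_space UNIV) (\<lambda>b. b)
        = distr (with_binomial M n) (count_space UNIV \<Otimes>\<^sub>M count_space UNIV) (\<lambda>(x, y). (W x, y))"
      by (rule pair_measure_distr) 
         (use W in \<open>auto intro!: prob_space_imp_sigma_finite measure_pmf.prob_space_distr\<close>)
    moreover have "distr ?B (count_space UNIV) (\<lambda>b. b) = ?B"
      by (rule distr_id2) simp
    ultimately show ?thesis
      unfolding prob_space.indep_var_distribution_eq[OF ps] using Wf s d1 d2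
      by (simp add: case_prod_beta')
  qed
qed

end

(* The law of W + B_n is, up to the factor 2^-n, the coefficient sequence c of (1 + X)^n p, where p is
   the generating function of W; dividing by a power of X one may assume p(0) > 0.  Let d be the degree
   of p.  For k more than L = 8 d^2 + 2 d away from both ends of {0..n+d}, expand
   2 (c_k^2 - c_(k-1) c_(k+1)) as a double sum over i, j <= d; each summand, symmetrised in i and j, is
   nonnegative, and positive for i = j = d, because the first-order deviations from 1 of the two
   products of binomial ratios cancel up to a negative remainder.  For each of the finitely many k
   near the left end, c_k / n^k tends to p(0) / k!, and 1 / k! is strictly log-concave; the right end
   is the left end of the reflected polynomial. *)
theory Submission
  imports Defs "HOL-Real_Asymp.Real_Asymp"
begin

section \<open>Exchange inequality for products of two binomial coefficients\<close>

text \<open>Since \<open>s \<le> Y + Z\<close>, the left side is at most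
  \<open>4 * d\<^sup>2 * (Y + Z)\<^sup>2\<close>. On the right each summand is at least
  \<open>Y * Z * (Y + Z - 1)\<close>; as \<open>Y\<close> and \<open>Z\<close> are at least
  \<open>K \<ge> 1\<close>, both together reach \<open>K * (Y + Z)\<^sup>2 / 2\<close>. Hence
  \<open>K > 8 * d\<^sup>2\<close> is enough.\<close>

lemma exchange_ratio_polynomial:
  fixes Y Z s d :: real
  assumes s: "0 \<le> s" "s \<le> d" and Y: "Y \<ge> 8 * d\<^sup>2 + d + 1" and Z: "Z \<ge> 8 * d\<^sup>2 + d + 1"
  shows "s\<^sup>2 * (Y + Z + s)\<^sup>2 < (Y + s) * (Z + s) * (Y + Z + 2 * s - 1) + Y * Z * (Y + Z - 1)"
proof -
  define K where "K = 8 * d\<^sup>2 + d + 1"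
  have d: "0 \<le> d" "0 \<le> d\<^sup>2" using s by auto
  have K: "K \<ge> 1" "K \<le> Y" "K \<le> Z" "s \<le> K" "8 * d\<^sup>2 < K" using d s Y Z unfolding K_def by linarith+
  have sd: "s\<^sup>2 \<le> d\<^sup>2" using s by (simp add: power_mono)
  have YZ: "K * (Y + Z) \<le> 2 * (Y * Z)"
  proof -
    have "K * Z \<le> Y * Z" "K * Y \<le> Z * Y"
      using K by (simp_all add: mult_right_mono)
    then show ?thesis by (simp add: distrib_left mult.commute)
  qed
  have le: "Y * Z * (Y + Z - 1) \<le> (Y + s) * (Z + s) * (Y + Z + 2 * s - 1)"
    by (intro mult_mono) (use K s in auto)
  have "s\<^sup>2 * (Y + Z + s)\<^sup>2 \<le> d\<^sup>2 * (2 * (Y + Z))\<^sup>2"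
    by (intro mult_mono power_mono sd) (use K s d in auto)
  also have "\<dots> = 8 * d\<^sup>2 * ((Y + Z)\<^sup>2 / 2)" by (simp add: power_mult_distrib del: distrib_left_numeral)
  also have "\<dots> < K * ((Y + Z)\<^sup>2 / 2)"
    by (rule mult_strict_right_mono) (use K in auto)
  also have "\<dots> = K * (Y + Z) * ((Y + Z) / 2)" by (simp add: power2_eq_square)
  also have "\<dots> \<le> 2 * (Y * Z) * (Y + Z - 1)"
    by (intro mult_mono YZ) (use K in auto)
  finally show ?thesis using le by simp
qed

text \<open>In \<open>binomial_exchange\<close> below, \<open>z = n - x\<close> and \<open>w = n - y\<close>. With \<open>A = (x + 1) (w + 1)\<close> and
  \<open>B = (y + 1) (z + 1)\<close> the claim becomes \<open>(A - B)\<^sup>2 < A (x + w + 1) + B (y + z + 1)\<close>, of degree 2 on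
  the left but 3 on the right, as \<open>x - y\<close> is bounded.\<close>
lemma exchange_ratio_less:
  fixes x y z w d :: real
  assumes sum: "x + z = y + w" and xy: "\<bar>x - y\<bar> \<le> d"
    and lb: "x \<ge> 8 * d\<^sup>2 + d" "y \<ge> 8 * d\<^sup>2 + d" "z \<ge> 8 * d\<^sup>2 + d" "w \<ge> 8 * d\<^sup>2 + d"
  shows "x * w / ((z + 1) * (y + 1)) + y * z / ((w + 1) * (x + 1)) < 2"
  using assms
proof (induction y x arbitrary: z w rule: linorder_wlog)
  \<comment> \<open>Swapping \<open>x\<close> with \<open>y\<close> and \<open>z\<close> with
    \<open>w\<close> exchanges the two fractions, so \<open>y \<le> x\<close> may be
    assumed.\<close>
  case (sym y x)
  have "y * z / ((w + 1) * (x + 1)) + x * w / ((z + 1) * (y + 1)) < 2"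
    by (rule sym.IH) (use sym.prems in \<open>auto simp: abs_minus_commute\<close>)
  then show ?case by simp
next
  case (le y x)
  define s where "s = x - y"
  define A where "A = (x + 1) * (w + 1)"
  define B where "B = (y + 1) * (z + 1)"
  have d: "0 \<le> d" "0 \<le> d\<^sup>2" using le.prems(2) by auto
  have pos: "0 \<le> x" "0 \<le> y" "0 \<le> z" "0 \<le> w" using le.prems(3-6) d by linarith+
  have AB: "A > 0" "B > 0" unfolding A_def B_def using pos by auto
  have eqs: "x = y + s" "w = z + s" using le.prems by (auto simp: s_def)
  \<comment> \<open>With \<open>Y = y + 1\<close> and \<open>Z = z + 1\<close> one has
    \<open>A = (Y + s) * (Z + s)\<close> and \<open>B = Y * Z\<close>, hence
    \<open>A - B = s * (Y + Z + s)\<close>.\<close>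
  have "s\<^sup>2 * ((y + 1) + (z + 1) + s)\<^sup>2 < ((y + 1) + s) * ((z + 1) + s) * ((y + 1) + (z + 1) + 2 * s - 1)
      + (y + 1) * (z + 1) * ((y + 1) + (z + 1) - 1)"
    by (rule exchange_ratio_polynomial[where d = d]) (use le in \<open>auto simp: s_def\<close>)
  also have "\<dots> = A * (x + w + 1) + B * (y + z + 1)"
    unfolding A_def B_def eqs by (simp add: algebra_simps)
  also have "s\<^sup>2 * ((y + 1) + (z + 1) + s)\<^sup>2 = (A - B)\<^sup>2"
    unfolding A_def B_def eqs by (simp add: algebra_simps power2_eq_square)
  finally have *: "(A - B)\<^sup>2 < A * (x + w + 1) + B * (y + z + 1)" .
  have xw: "x * w = A - (x + w + 1)" and yz: "y * z = B - (y + z + 1)"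
    by (simp_all add: A_def B_def algebra_simps)
  have "A * (x * w) + B * (y * z) < 2 * (A * B)"
    unfolding xw yz using * by (simp add: algebra_simps power2_eq_square)
  then have "x * w / B + y * z / A < 2"
    using AB by (simp add: add_frac_eq divide_less_eq mult_ac)
  then show ?case by (simp add: A_def B_def mult.commute)
qed

lemma binomial_Suc_ratio:
  assumes "x \<le> n"
  shows "real (n choose Suc x) = real (n choose x) * (real (n - x) / (real x + 1))"
proof -
  \<comment> \<open>Both sides equal \<open>n * ((n - 1) choose x)\<close>.\<close>
  have "Suc x * (n choose Suc x) = (n - x) * (n choose x)"
    using times_binomial_minus1_eq[of "Suc x" n] binomial_absorb_comp[of n x] by simp
  then have "real (Suc x) * real (n choose Suc x) = real (n - x) * real (n choose x)"
    by (metis of_nat_mult)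
  then show ?thesis by (simp add: field_simps del: of_nat_diff)
qed

text \<open>Division by \<open>(n choose x) * (n choose y)\<close> leaves the two ratios of
  \<open>exchange_ratio_less\<close>. One of them alone may exceed 1 when \<open>x\<close> and
  \<open>y\<close> differ; only their sum is controlled.\<close>

lemma binomial_exchange:
  fixes n x y d :: nat
  defines "L \<equiv> 8 * d\<^sup>2 + d"
  assumes xy: "x \<le> y + d" "y \<le> x + d"
    and lb: "L < x" "L < y" "x + L < n" "y + L < n"
  shows "real (n choose (x - 1)) * real (n choose (y + 1)) + real (n choose (x + 1)) * real (n choose (y - 1))
     < 2 * (real (n choose x) * real (n choose y))"
proof -
  have down: "real (n choose (m - 1)) = real (n choose m) * (real m / (real (n - m) + 1))" if m: "0 < m" "m \<le> n" for m
  proof -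
    obtain j where j: "m = Suc j" using m by (cases m) auto
    show ?thesis using m binomial_Suc_ratio[of j n] by (auto simp: j field_simps)
  qed
  have "real L = 8 * (real d)\<^sup>2 + real d" by (simp add: L_def)
  then have ratio: "real x * real (n - y) / ((real (n - x) + 1) * (real y + 1)) +
     real y * real (n - x) / ((real (n - y) + 1) * (real x + 1)) < 2"
    using xy lb by (intro exchange_ratio_less[where d = "real d"]) auto
  have pos: "0 < real (n choose x) * real (n choose y)" using lb by simp
  have le: "0 < x" "x \<le> n" "0 < y" "y \<le> n" using lb by auto
  have up: "real (n choose (m + 1)) = real (n choose m) * (real (n - m) / (real m + 1))" if "m \<le> n" for m
    using binomial_Suc_ratio[OF that] by simp
  have "real (n choose (x - 1)) * real (n choose (y + 1)) + real (n choose (x + 1)) * real (n choose (y - 1))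
    = (real (n choose x) * real (n choose y)) *
     (real x * real (n - y) / ((real (n - x) + 1) * (real y + 1)) +
     real y * real (n - x) / ((real (n - y) + 1) * (real x + 1)))"
    unfolding down[OF le(1,2)] down[OF le(3,4)] up[OF le(2)] up[OF le(4)]
    by (simp add: algebra_simps del: of_nat_diff)
  also have "\<dots> < (real (n choose x) * real (n choose y)) * 2"
    by (rule mult_strict_left_mono[OF ratio pos])
  finally show ?thesis by simp
qed

section \<open>Binomial asymptotics and the coefficients of (1 + X)^n p\<close>

lemma binomial_over_power_tendsto:
  "(\<lambda>n. real (n choose m) / real n ^ m) \<longlonglongrightarrow> 1 / fact m"
proof (induction m)
  case (Suc m)
  have "(\<lambda>n. (real n - real m) / ((real m + 1) * real n)) \<longlonglongrightarrow> 1 / (real m + 1)"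
    by (real_asymp simp: field_simps)
  with Suc have "(\<lambda>n. real (n choose m) / real n ^ m * ((real n - real m) / ((real m + 1) * real n)))
      \<longlonglongrightarrow> 1 / fact m * (1 / (real m + 1))"
    by (rule tendsto_mult)
  moreover have "\<forall>\<^sub>F n in sequentially. real (n choose m) / real n ^ m * ((real n - real m) / ((real m + 1) * real n))
      = real (n choose Suc m) / real n ^ Suc m"
    using eventually_ge_at_top[of m]
    by eventually_elim (simp add: binomial_Suc_ratio)
  ultimately show ?case
    by (simp add: tendsto_cong algebra_simps)
qed simp

lemma coeff_one_plus_X_power:
  "coeff ([:1, 1:] ^ n :: real poly) k = real (n choose k)"
proof (cases "k \<le> n")
  case False
  moreover have "degree ([:1, 1:] ^ n :: real poly) \<le> n"
    using degree_power_le[of "[:1, 1:] :: real poly" n] by simp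
  ultimately show ?thesis by (simp add: coeff_eq_0 binomial_eq_0)
qed (simp add: coeff_linear_poly_power)

lemma coeff_binomial_mult:
  "coeff ([:1, 1:] ^ n * p) k = (\<Sum>i\<le>k. coeff p i * real (n choose (k - i)))"
  by (subst mult.commute) (simp add: coeff_mult coeff_one_plus_X_power)

text \<open>The range of summation no longer depends on \<open>k\<close>, so neighbouring
  coefficients become sums over one index set and can be multiplied termwise.\<close>

lemma coeff_binomial_mult_middle:
  assumes "degree p \<le> k"
  shows "coeff ([:1, 1:] ^ n * p) k = (\<Sum>i\<le>degree p. coeff p i * real (n choose (k - i)))"
  unfolding coeff_binomial_mult using assms
  by (intro sum.mono_neutral_right) (auto simp: coeff_eq_0)

section \<open>Indices far from both ends\<close>

lemma strict_log_concave_middle: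
  fixes p :: "real poly"
  defines "d \<equiv> degree p"
  defines "L \<equiv> 8 * d\<^sup>2 + 2 * d"
  assumes nonneg: "\<And>i. coeff p i \<ge> 0" and p: "p \<noteq> 0" and k: "L < k" "k + L < n + d"
  shows "coeff ([:1, 1:] ^ n * p) (k - 1) * coeff ([:1, 1:] ^ n * p) (k + 1)
    < (coeff ([:1, 1:] ^ n * p) k)\<^sup>2"
proof -
  define a where "a i = real (n choose (k - i))" for i
  define am where "am i = real (n choose (k - i - 1))" for i
  define ap where "ap i = real (n choose (k - i + 1))" for i
  define q where "q = coeff p"
  let ?T = "\<lambda>i j. q i * q j * (2 * (a i * a j) - (am i * ap j + ap i * am j))"
  have c: "coeff ([:1, 1:] ^ n * p) k = (\<Sum>i\<le>d. q i * a i)"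
    using k by (subst coeff_binomial_mult_middle) (auto simp: d_def L_def q_def a_def)
  have cm: "coeff ([:1, 1:] ^ n * p) (k - 1) = (\<Sum>i\<le>d. q i * am i)"
    using k by (subst coeff_binomial_mult_middle) (auto simp: d_def L_def q_def am_def diff_commute)
  have cp: "coeff ([:1, 1:] ^ n * p) (k + 1) = (\<Sum>i\<le>d. q i * ap i)"
    using k by (subst coeff_binomial_mult_middle) (auto simp: d_def L_def q_def ap_def Suc_diff_le)
  \<comment> \<open>The indices \<open>k - i\<close> and \<open>k - j\<close> differ by at most
    \<open>d\<close>. The bound \<open>L\<close> exceeds the one in \<open>binomial_exchange\<close>
    by \<open>d\<close>, which absorbs the shifts by \<open>i\<close> and \<open>j\<close>.\<close>
  have ex: "am i * ap j + ap i * am j < 2 * (a i * a j)" if "i \<le> d" "j \<le> d" for i j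
    unfolding am_def ap_def a_def
    by (rule binomial_exchange[where d = d]) (use that k in \<open>auto simp: L_def\<close>)
  have prod_eq: "(\<Sum>i\<le>d. q i * u i) * (\<Sum>i\<le>d. q i * v i) = (\<Sum>i\<le>d. \<Sum>j\<le>d. q i * q j * (u i * v j))"
    for u v :: "nat \<Rightarrow> real"
    by (simp add: sum_product mult_ac)
  have "0 < (\<Sum>i\<le>d. \<Sum>j\<le>d. ?T i j)"
  proof -
    have nn: "0 \<le> ?T i j" if "i \<le> d" "j \<le> d" for i j
      using nonneg ex[OF that] by (simp add: q_def)
    \<comment> \<open>Other coefficients may vanish, but the leading one is positive, so this
      summand makes the inequality strict.\<close>
    have "0 < ?T d d"
      using ex[of d d] nonneg[of d] p by (simp add: q_def d_def less_le)
    also have "\<dots> \<le> (\<Sum>j\<le>d. ?T d j)"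
      by (rule member_le_sum[of d _ "?T d"]) (use nn in auto)
    also have "\<dots> \<le> (\<Sum>i\<le>d. \<Sum>j\<le>d. ?T i j)"
      by (rule member_le_sum[of d _ "\<lambda>i. \<Sum>j\<le>d. ?T i j"]) (use nn in \<open>auto intro!: sum_nonneg\<close>)
    finally show ?thesis .
  qed
  \<comment> \<open>Both mixed terms sum to the same product of the two neighbouring coefficients,
    so symmetrising merely doubles the difference.\<close>
  also have "\<dots> = 2 * (\<Sum>i\<le>d. q i * a i)\<^sup>2 - ((\<Sum>i\<le>d. q i * am i) * (\<Sum>i\<le>d. q i * ap i) +
       (\<Sum>i\<le>d. q i * ap i) * (\<Sum>i\<le>d. q i * am i))"
    unfolding power2_eq_square prod_eq
    by (simp add: sum_distrib_left sum_subtractf sum.distrib right_diff_distrib distrib_left mult_ac)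
  finally show ?thesis unfolding c cm cp by (simp add: mult.commute)
qed

section \<open>Indices near the left end, for large n\<close>

text \<open>The \<open>i\<close>-th summand has order \<open>n ^ (k - i)\<close>, so after division
  by \<open>n ^ k\<close> only \<open>i = 0\<close> survives.\<close>

lemma coeff_binomial_mult_tendsto:
  "(\<lambda>n. coeff ([:1, 1:] ^ n * p) k / real n ^ k) \<longlonglongrightarrow> coeff p 0 / fact k"
proof -
  have t: "(\<lambda>n. coeff p i * (real (n choose (k - i)) / real n ^ k)) \<longlonglongrightarrow> (if i = 0 then coeff p 0 / fact k else 0)"
    if i: "i \<le> k" for i
  proof (cases "i = 0")
    case True
    then show ?thesis
      using tendsto_mult_left[OF binomial_over_power_tendsto[of k], of "coeff p 0"] by simp
  next
    case False
    have "(\<lambda>n. 1 / real n ^ i) \<longlonglongrightarrow> 0" using False by real_asymp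
    with binomial_over_power_tendsto[of "k - i"]
    have "(\<lambda>n. real (n choose (k - i)) / real n ^ (k - i) * (1 / real n ^ i)) \<longlonglongrightarrow> 1 / fact (k - i) * 0"
      by (rule tendsto_mult)
    moreover have "real n ^ (k - i) * real n ^ i = real n ^ k" for n
      using i by (simp flip: power_add)
    ultimately have "(\<lambda>n. real (n choose (k - i)) / real n ^ k) \<longlonglongrightarrow> 0" by simp
    from tendsto_mult_left[OF this, of "coeff p i"] show ?thesis using False by simp
  qed
  have "(\<lambda>n. \<Sum>i\<le>k. coeff p i * (real (n choose (k - i)) / real n ^ k)) \<longlonglongrightarrow>
      (\<Sum>i\<le>k. if i = 0 then coeff p 0 / fact k else 0)"
    by (rule tendsto_sum) (use t in auto)
  then show ?thesis by (simp add: coeff_binomial_mult sum_divide_distrib)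
qed

lemma eventually_strict_log_concave_left:
  fixes p :: "real poly"
  assumes p: "coeff p 0 \<noteq> 0" and k: "0 < k"
  shows "\<forall>\<^sub>F n in sequentially. coeff ([:1, 1:] ^ n * p) (k - 1) * coeff ([:1, 1:] ^ n * p) (k + 1)
    < (coeff ([:1, 1:] ^ n * p) k)\<^sup>2"
proof -
  let ?c = "\<lambda>n k. coeff ([:1, 1:] ^ n * p) k"
  obtain j where j: "k = Suc j" using k by (cases k) auto
  \<comment> \<open>Cancelling common factors leaves \<open>k < k + 1\<close>.\<close>
  have "(fact k :: real)\<^sup>2 < fact j * fact (Suc k)"
    by (simp add: j power2_eq_square)
  then have fact: "(1 :: real) / fact j * (1 / fact (Suc k)) < (1 / fact k)\<^sup>2"
    by (simp add: power_divide divide_strict_left_mono del: fact_Suc)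
  have "(\<lambda>n. (?c n k / real n ^ k)\<^sup>2 - (?c n j / real n ^ j) * (?c n (Suc k) / real n ^ Suc k)) \<longlonglongrightarrow>
     (coeff p 0 / fact k)\<^sup>2 - (coeff p 0 / fact j) * (coeff p 0 / fact (Suc k))"
    by (intro tendsto_intros coeff_binomial_mult_tendsto)
  moreover have "0 < (coeff p 0)\<^sup>2" using p by simp
  from mult_strict_left_mono[OF fact this]
  have "(coeff p 0 / fact k)\<^sup>2 - (coeff p 0 / fact j) * (coeff p 0 / fact (Suc k)) > 0"
    by (simp add: power2_eq_square mult_ac)
  ultimately have "\<forall>\<^sub>F n in sequentially.
      0 < (?c n k / real n ^ k)\<^sup>2 - (?c n j / real n ^ j) * (?c n (Suc k) / real n ^ Suc k)"
    by (rule order_tendstoD)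
  then show ?thesis
    using eventually_gt_at_top[of 0]
  proof eventually_elim
    case (elim n)
    \<comment> \<open>The exponents \<open>j\<close> and \<open>Suc k\<close> add up to
      \<open>2 * k\<close>, so both products carry the same positive normalisation, and the sign is
      unaffected.\<close>
    have eq: "(?c n k / real n ^ k)\<^sup>2 - (?c n j / real n ^ j) * (?c n (Suc k) / real n ^ Suc k)
       = ((?c n k)\<^sup>2 - ?c n j * ?c n (Suc k)) / real n ^ (2 * k)"
      using elim(2) by (simp add: j field_simps power2_eq_square power_mult)
    have "0 < real n ^ (2 * k)" using elim(2) by simp
    with elim(1) have "0 < (?c n k)\<^sup>2 - ?c n j * ?c n (Suc k)"
      unfolding eq by (auto simp: zero_less_divide_iff)
    then show ?case by (simp add: j)
  qed
qed

section \<open>All indices at once\<close>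

text \<open>The margin \<open>L\<close> depends only on the degree. Each end thus contributes a
  fixed finite set of eventual conditions, while the middle estimate holds for every
  \<open>n\<close>.\<close>

lemma eventually_strict_log_concave:
  fixes p :: "real poly"
  assumes nonneg: "\<And>i. coeff p i \<ge> 0" and p: "coeff p 0 \<noteq> 0"
  shows "\<forall>\<^sub>F n in sequentially. \<forall>k. 0 < k \<and> k < n + degree p \<longrightarrow>
    coeff ([:1, 1:] ^ n * p) (k - 1) * coeff ([:1, 1:] ^ n * p) (k + 1) < (coeff ([:1, 1:] ^ n * p) k)\<^sup>2"
proof -
  define d where "d = degree p"
  define L where "L = 8 * d\<^sup>2 + 2 * d"
  define r where "r = reflect_poly p"
  let ?lc = "\<lambda>p n k. coeff ([:1, 1:] ^ n * p) (k - 1) * coeff ([:1, 1:] ^ n * p) (k + 1) < (coeff ([:1, 1:] ^ n * p) k)\<^sup>2"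
  have p0: "p \<noteq> 0" using p by auto
  \<comment> \<open>The constant coefficient of the reflection is the leading coefficient of
    \<open>p\<close>.\<close>
  have r0: "coeff r 0 \<noteq> 0" using p0 by (simp add: r_def)
  have left: "\<forall>\<^sub>F n in sequentially. \<forall>k\<in>{0<..L}. ?lc p n k"
    by (intro eventually_ball_finite ballI eventually_strict_log_concave_left p) auto
  have right: "\<forall>\<^sub>F n in sequentially. \<forall>k\<in>{0<..L}. ?lc r n k"
    by (intro eventually_ball_finite ballI eventually_strict_log_concave_left r0) auto
  show ?thesis using left right
  proof eventually_elim
    case (elim n)
    \<comment> \<open>The factor \<open>[:1, 1:]\<close> is its own reflection.\<close>
    have refl: "[:1, 1:] ^ n * r = reflect_poly ([:1, 1:] ^ n * p)"
      using reflect_poly_pCons[of "1 :: real" "[:1:]"] by (simp add: r_def reflect_poly_mult reflect_poly_power)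
    have deg: "degree ([:1, 1:] ^ n * p) = n + d"
      using p0 by (simp add: degree_mult_eq degree_linear_power d_def)
    have flip: "coeff ([:1, 1:] ^ n * r) m = coeff ([:1, 1:] ^ n * p) (n + d - m)" if "m \<le> n + d" for m
      using that by (simp add: refl coeff_reflect_poly deg)
    show ?case
    proof (intro allI impI)
      fix k assume k: "0 < k \<and> k < n + degree p"
      consider "k \<le> L" | "n + d - k \<le> L" | "L < k" "k + L < n + d" by linarith
      then show "?lc p n k"
      proof cases
        case 1
        then show ?thesis using elim(1) k by auto
      next
        case 2
        let ?m = "n + d - k"
        have k': "0 < k" "k < n + d" using k by (auto simp: d_def)
        have idx: "n + d - (?m - 1) = k + 1" "n + d - (?m + 1) = k - 1" "n + d - ?m = k"
          using k' by auto
        have "?lc r n ?m" using elim(2) 2 k' by (meson greaterThanAtMost_iff zero_less_diff)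
        then show ?thesis
          using flip[of "?m - 1", unfolded idx] flip[of "?m + 1", unfolded idx] flip[of ?m, unfolded idx] k'
          by (simp add: mult.commute)
      next
        case 3
        then show ?thesis
          using strict_log_concave_middle[of p k n] nonneg p0 by (simp add: L_def d_def)
      qed
    qed
  qed
qed

lemma ex_strictly_log_concave:
  fixes p :: "real poly"
  assumes nonneg: "\<And>i. coeff p i \<ge> 0" and p: "p \<noteq> 0"
  shows "\<exists>n. strictly_log_concave (coeff ([:1, 1:] ^ n * p))"
proof -
  \<comment> \<open>Here \<open>a\<close> is the least index of a nonzero coefficient; dividing by
    \<open>X^a\<close> gives a polynomial with nonzero constant coefficient.\<close>
  define a where "a = order 0 p"
  obtain q where q: "p = monom 1 a * q" "\<not> [:0, 1:] dvd q"
    using order_decomp[OF p, of 0] by (auto simp: a_def monom_altdef)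
  have q0: "coeff q 0 \<noteq> 0"
    using q(2) poly_eq_0_iff_dvd[of q 0] by (simp add: poly_0_coeff_0)
  have "coeff q i \<ge> 0" for i
    using nonneg[of "i + a"] by (simp add: q(1) coeff_monom_mult)
  from eventually_strict_log_concave[OF this q0] obtain n where
    n: "\<And>k. 0 < k \<Longrightarrow> k < n + degree q \<Longrightarrow>
    coeff ([:1, 1:] ^ n * q) (k - 1) * coeff ([:1, 1:] ^ n * q) (k + 1) < (coeff ([:1, 1:] ^ n * q) k)\<^sup>2"
    using eventually_happens'[OF sequentially_bot] by blast
  define c where "c = [:1, 1:] ^ n * q"
  have qne: "q \<noteq> 0" using q0 by auto
  have deg: "degree c = n + degree q"
    using qne by (simp add: c_def degree_mult_eq degree_linear_power)
  have cne: "c \<noteq> 0" using qne by (simp add: c_def)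
  have "coeff c 0 = coeff q 0" by (simp add: c_def coeff_binomial_mult)
  then have c0: "coeff c 0 \<noteq> 0" using q0 by simp
  have "[:1, 1:] ^ n * p = monom 1 a * c"
    by (simp add: q(1) c_def mult_ac)
  then have co: "coeff ([:1, 1:] ^ n * p) k = (if k < a then 0 else coeff c (k - a))" for k
    by (simp add: coeff_monom_mult)
  have "strictly_log_concave (coeff ([:1, 1:] ^ n * p))"
    unfolding strictly_log_concave_def co
  \<comment> \<open>The end values are the constant and the leading coefficient of \<open>c\<close>,
    both nonzero.\<close>
  proof (rule exI[of _ a], rule exI[of _ "a + degree c"], intro conjI allI impI)
    fix i
    assume "(if i < a then 0 else coeff c (i - a)) \<noteq> 0"
    then show "a \<le> i" "i \<le> a + degree c"
      using le_degree[of c "i - a"] by (auto split: if_splits)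
  next
    fix i assume i: "a < i \<and> i < a + degree c"
    then have "0 < i - a" "i - a < n + degree q" by (auto simp: deg)
    then have "coeff c (i - a - 1) * coeff c (i - a + 1) < (coeff c (i - a))\<^sup>2"
      unfolding c_def by (rule n)
    \<comment> \<open>Because \<open>a < i\<close>, no subtraction is truncated and the left
      neighbour stays at or above \<open>a\<close>.\<close>
    moreover have "i - 1 - a = i - a - 1" "i + 1 - a = i - a + 1" using i by auto
    ultimately show "(if i - 1 < a then 0 else coeff c (i - 1 - a)) * (if i + 1 < a then 0 else coeff c (i + 1 - a))
        < (if i < a then 0 else coeff c (i - a))\<^sup>2"
      using i by auto
  qed (use c0 cne in auto)
  then show ?thesis by blast
qed

section \<open>From coefficient sequences back to laws of random variables\<close>

lemma strictly_log_concave_scale: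
  assumes "strictly_log_concave \<mu>" "c \<noteq> 0"
  shows "strictly_log_concave (\<lambda>i. c * \<mu> i)"
proof -
  from assms(1) obtain a b where ab: "\<mu> a \<noteq> 0" "\<mu> b \<noteq> 0" "\<And>i. \<mu> i \<noteq> 0 \<Longrightarrow> a \<le> i \<and> i \<le> b"
     and s: "\<And>i. a < i \<Longrightarrow> i < b \<Longrightarrow> (\<mu> i)\<^sup>2 > \<mu> (i - 1) * \<mu> (i + 1)"
    unfolding strictly_log_concave_def by blast
  have "0 < c\<^sup>2" using assms(2) by simp
  then have "(c * \<mu> i)\<^sup>2 > (c * \<mu> (i - 1)) * (c * \<mu> (i + 1))" if "a < i" "i < b" for i
    using mult_strict_left_mono[OF s[OF that], of "c\<^sup>2"]
    by (simp add: power2_eq_square mult_ac)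
  with ab assms(2) show ?thesis
    unfolding strictly_log_concave_def by - (rule exI[of _ a], rule exI[of _ b], auto)
qed

text \<open>The event that the sum is \<open>k\<close> splits by the value \<open>i\<close> of
  \<open>W\<close> into disjoint rectangles, whose measures factor; this is the convolution formula,
  and its sum has the form of \<open>coeff_binomial_mult\<close>.\<close>

lemma measure_sum_with_binomial:
  fixes M :: "'a measure" and W :: "'a \<Rightarrow> nat"
  assumes M: "prob_space M" and W: "W \<in> measurable M (count_space UNIV)"
  shows "measure (distr (with_binomial M n) (count_space UNIV) (\<lambda>\<omega>. W (fst \<omega>) + snd \<omega>)) {k}
    = (1/2) ^ n * (\<Sum>i\<le>k. measure M {\<omega> \<in> space M. W \<omega> = i} * real (n choose (k - i)))"
proof -
  let ?B = "measure_pmf (binomial_pmf n (1/2))"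
  let ?E = "\<lambda>i. {\<omega> \<in> space M. W \<omega> = i} \<times> {k - i}"
  interpret M: prob_space M by (rule M)
  interpret P: pair_prob_space M ?B ..
  have [measurable]: "W \<in> measurable M (count_space UNIV)" by (rule W)
  have E: "?E i \<in> sets (with_binomial M n)" for i by (rule pair_measureI) auto
  have pmf: "pmf (binomial_pmf n (1/2)) j = real (n choose j) * (1/2) ^ n" for j
    by (cases "j \<le> n") (auto simp: binomial_eq_0 simp flip: power_add)
  have "measure (distr (with_binomial M n) (count_space UNIV) (\<lambda>\<omega>. W (fst \<omega>) + snd \<omega>)) {k}
     = measure (with_binomial M n) ((\<lambda>\<omega>. W (fst \<omega>) + snd \<omega>) -` {k} \<inter> space (with_binomial M n))"
    by (rule measure_distr) auto
  also have "(\<lambda>\<omega>. W (fst \<omega>) + snd \<omega>) -` {k} \<inter> space (with_binomial M n) = (\<Union>i\<le>k. ?E i)"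
    by (auto simp: space_pair_measure)
  also have "measure (with_binomial M n) \<dots> = (\<Sum>i\<le>k. measure (with_binomial M n) (?E i))"
    by (rule P.finite_measure_finite_Union) (use E in \<open>auto simp: disjoint_family_on_def\<close>)
  also have "\<dots> = (\<Sum>i\<le>k. measure M {\<omega> \<in> space M. W \<omega> = i} * (real (n choose (k - i)) * (1/2) ^ n))"
    by (intro sum.cong refl)
       (simp add: measure_def measure_pmf.emeasure_pair_measure_Times enn2real_mult pmf[symmetric] pmf.rep_eq)
  finally show ?thesis by (simp add: sum_distrib_left mult_ac)
qed

theorem theorem3p9:
  fixes M :: "'a measure" and W :: "'a \<Rightarrow> nat" and n\<^sub>0 :: nat
  assumes "prob_space M"
    and "W \<in> measurable M (count_space UNIV)"
    and "AE \<omega> in M. W \<omega> \<in> {0..n\<^sub>0}"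
  shows "\<exists>n. strictly_log_concave_rv (with_binomial M n) (\<lambda>\<omega>. W (fst \<omega>) + snd \<omega>)"
proof -
  interpret prob_space M by fact
  have [measurable]: "W \<in> measurable M (count_space UNIV)" by fact
  define w where "w i = prob {\<omega> \<in> space M. W \<omega> = i}" for i
  have w0: "w i = 0" if "i > n\<^sub>0" for i
    unfolding w_def using assms(3) that by (intro prob_eq_0_AE) auto
  \<comment> \<open>The generating function of \<open>W\<close>; it is a polynomial because
    \<open>w\<close> vanishes beyond \<open>n\<^sub>0\<close>.\<close>
  define p where "p = (\<Sum>i\<le>n\<^sub>0. monom (w i) i)"
  have cp: "coeff p i = w i" for i
    using w0[of i] by (auto simp: p_def coeff_sum)
  \<comment> \<open>Otherwise \<open>W\<close> would almost surely avoid each natural number, hence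
    all of them by countability.\<close>
  have "p \<noteq> 0"
  proof
    assume "p = 0"
    then have "w i = 0" for i using cp[of i] by simp
    then have "AE \<omega> in M. W \<omega> \<noteq> i" for i
      unfolding w_def by (subst (asm) prob_eq_0) auto
    then have "AE \<omega> in M. \<forall>i. W \<omega> \<noteq> i" unfolding AE_all_countable by blast
    then have "AE \<omega> in M. False" by simp
    then show False by simp
  qed
  moreover have "coeff p i \<ge> 0" for i by (simp add: cp w_def)
  ultimately obtain n where "strictly_log_concave (coeff ([:1, 1:] ^ n * p))"
    using ex_strictly_log_concave by blast
  then have "strictly_log_concave (\<lambda>k. (1/2) ^ n * coeff ([:1, 1:] ^ n * p) k)"
    by (rule strictly_log_concave_scale) simp
  then have "strictly_log_concave_rv (with_binomial M n) (\<lambda>\<omega>. W (fst \<omega>) + snd \<omega>)"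
    unfolding strictly_log_concave_rv_def measure_sum_with_binomial[OF assms(1,2)]
    by (simp add: coeff_binomial_mult cp w_def)
  then show ?thesis by blast
qed

end
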